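(* Let $k\geq 2$ and $n$ be positive integers, and let $\mathcal{F}\subset 2^{[n]}$ be a $k$-cross-free family. Then $|\mathcal{F}|=O_{k}(n\log^{*}n)$, i.e. there is a constant $c_k>0$ depending only on $k$ such that $|\mathcal{F}|\leq c_k\, n\log^{*}n$ for all such $n$ and $\mathcal{F}$.
   Context: $[n]=\{1,\dots,n\}$ and $2^{[n]}$ is the family of all subsets of $[n]$. Two sets $A,B\subset[n]$ are crossing if $A\setminus B$, $B\setminus A$, $A\cap B$ and $[n]\setminus(A\cup B)$ are all non-empty. A family $\mathcal{F}\subset 2^{[n]}$ is $k$-cross-free if it does not contain $k$ pairwise crossing sets. $\log$ is base 2, $\log_{(i)}n$ denotes the $i$-fold iterated logarithm, and $\log^{*}n$ is the largest positive integer $i$ such that $\log_{(i)}n>1$. *)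

theory Defs
  imports Complex_Main
begin

definition crossing :: "nat \<Rightarrow> nat set \<Rightarrow> nat set \<Rightarrow> bool" where
  "crossing n A B \<longleftrightarrow> A - B \<noteq> {} \<and> B - A \<noteq> {} \<and> A \<inter> B \<noteq> {} \<and> {1..n} - (A \<union> B) \<noteq> {}"

definition k_cross_free :: "nat \<Rightarrow> nat \<Rightarrow> nat set set \<Rightarrow> bool" where
  "k_cross_free n k F \<longleftrightarrow>
     \<not> (\<exists>S. S \<subseteq> F \<and> card S = k \<and> (\<forall>A\<in>S. \<forall>B\<in>S. A \<noteq> B \<longrightarrow> crossing n A B))"

definition iter_log :: "nat \<Rightarrow> real \<Rightarrow> real" where
  "iter_log i x = ((\<lambda>y. log 2 y) ^^ i) x"

(* largest positive i with log_(i) n > 1 (all earlier iterates then also exceed 1);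
   convention: 1 if there is no such i (i.e. n \<le> 2) *)
definition log_star :: "nat \<Rightarrow> nat" where
  "log_star n = Max ({1} \<union> {i. 1 \<le> i \<and> (\<forall>j\<in>{1..i}. iter_log j (real n) > 1)})"

end

theory Submission
  imports Defs "HOL-Library.Ramsey"
begin

text \<open>
  Replacing every set that contains \<open>n\<close> by its complement, we may assume that no set contains \<open>n\<close>;
  crossing then means weakly crossing: the sets meet and are incomparable. We show that the members
  with size between \<open>s\<close> and \<open>2\<^sup>s\<close> number \<open>O\<^sub>k(n)\<close>; iterating \<open>s \<mapsto> 2\<^sup>s\<close>, about \<open>log\<^sup>* n\<close> such
  blocks cover all sizes.

  Fix a small \<open>g\<close> proportional to \<open>s\<close> and let \<open>P A\<close> be a largest proper subset of \<open>A\<close> in the family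
  that misses at most \<open>g\<close> elements of \<open>A\<close>. Weighting the incidences \<open>x \<in> A\<close> by \<open>1 / |A|\<close> shows that only
  \<open>O\<^sub>k(n)\<close> sets have no such \<open>P A\<close>, because the sets through \<open>x\<close> without one are sparse. For the
  others pick \<open>y \<in> A - P A\<close>. If there are many sets, then some \<open>y\<close> is picked by a long chain of sets,
  and of two sets \<open>A \<subset> B\<close> in the chain, \<open>A\<close> weakly crosses \<open>P B\<close>. This yields two crossing sets; to
  get \<open>l + 2\<close> of them around all but \<open>O\<^sub>k(n)\<close> sets, take the crossing configurations of size \<open>l + 1\<close>
  at the iterated predecessors of two sets of the chain, keep from the first one the sets that contain
  \<open>y\<close> and from the second one those that avoid \<open>y\<close>, and add the first set itself.
\<close>

subsection \<open>Weakly crossing families and predecessors\<close>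

definition weakly_crossing :: "'a set \<Rightarrow> 'a set \<Rightarrow> bool" where
  "weakly_crossing A B \<longleftrightarrow> A \<inter> B \<noteq> {} \<and> \<not> A \<subseteq> B \<and> \<not> B \<subseteq> A"

lemma weakly_crossing_commute: "weakly_crossing A B \<longleftrightarrow> weakly_crossing B A"
  by (auto simp: weakly_crossing_def)

lemma card_le_fibres:
  assumes "finite B" "f ` A \<subseteq> B" and "\<And>b. b \<in> B \<Longrightarrow> card {a \<in> A. f a = b} \<le> N"
  shows "card A \<le> N * card B"
proof -
  have "A = (\<Union>b\<in>B. {a \<in> A. f a = b})" using assms(2) by auto
  hence "card A \<le> (\<Sum>b\<in>B. card {a \<in> A. f a = b})"
    using card_UN_le[OF assms(1), of "\<lambda>b. {a \<in> A. f a = b}"] by simp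
  also have "\<dots> \<le> (\<Sum>b\<in>B. N)" using assms(3) by (intro sum_mono) auto
  finally show ?thesis by (simp add: mult.commute)
qed

lemma ex_large_fibre:
  assumes "finite B" "f ` A \<subseteq> B" "N * card B < card A"
  shows "\<exists>b\<in>B. N < card {a \<in> A. f a = b}"
  using card_le_fibres[OF assms(1,2), of N] assms(3) by (meson leD leI)

text \<open>Bounds the number of sets whose \<open>d\<close>-th iterate under \<open>P\<close> drops
  below a given lower size: fewer than \<open>k\<close> minimal sets, plus at most \<open>k\<close>
  preimages under \<open>P\<close> of each set that is exceptional for \<open>d\<close>.\<close>

fun exc :: "nat \<Rightarrow> nat \<Rightarrow> nat" where
  "exc k 0 = 0"
| "exc k (Suc d) = k + k * exc k d"

text \<open>Weak crossing stands in for crossing once all sets avoid a fixed point. Excluding the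
  empty set makes comparable members meet and gives every member a size to divide by.\<close>

locale weak_free =
  fixes k :: nat and U :: "'a set" and G :: "'a set set"
  assumes finite_U: "finite U" and G_sub: "G \<subseteq> Pow U" and G_ne: "{} \<notin> G"
    and card_pairwise_less: "\<And>S. S \<subseteq> G \<Longrightarrow> pairwise weakly_crossing S \<Longrightarrow> card S < k"
begin

lemma finite_G: "finite G"
  using finite_U G_sub by (simp add: finite_subset)

lemma finite_member: "A \<in> G \<Longrightarrow> finite A"
  using finite_U G_sub by (meson PowD finite_subset subsetD)

lemma antichain_card_less:
  assumes "S \<subseteq> G" "\<And>A B. A \<in> S \<Longrightarrow> B \<in> S \<Longrightarrow> A \<inter> B \<noteq> {}"
    "\<And>A B. A \<in> S \<Longrightarrow> B \<in> S \<Longrightarrow> \<not> A \<subset> B"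
  shows "card S < k"
proof (rule card_pairwise_less[OF assms(1)])
  show "pairwise weakly_crossing S"
    unfolding pairwise_def weakly_crossing_def using assms(2,3) by blast
qed

end

text \<open>The default \<open>P A = A\<close> encodes that \<open>A\<close> has no predecessor.
  \<open>P_max\<close> may speak of all proper subsets in \<open>G\<close>: one that misses more
  than \<open>g\<close> elements is smaller than \<open>P A\<close> anyway.\<close>

locale pred_family = weak_free +
  fixes P :: "'a set \<Rightarrow> 'a set" and g s :: nat
  assumes P_in: "\<And>A. A \<in> G \<Longrightarrow> P A \<in> G"
    and P_sub: "\<And>A. A \<in> G \<Longrightarrow> P A \<subseteq> A"
    and P_gap: "\<And>A. A \<in> G \<Longrightarrow> card (A - P A) \<le> g"
    and P_max: "\<And>A B. A \<in> G \<Longrightarrow> B \<in> G \<Longrightarrow> B \<subset> A \<Longrightarrow> card B \<le> card (P A)"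
    and size_ge: "\<And>A. A \<in> G \<Longrightarrow> s \<le> card A"
begin

definition Q :: "'a set set" where "Q = {A \<in> G. P A = A}"

lemma finite_Q: "finite Q"
  using finite_G by (simp add: Q_def)

lemma Pn_in: "A \<in> G \<Longrightarrow> (P ^^ i) A \<in> G"
  by (induction i) (auto simp: P_in)

lemma Pn_antimono: "A \<in> G \<Longrightarrow> i \<le> j \<Longrightarrow> (P ^^ j) A \<subseteq> (P ^^ i) A"
proof (induction j)
  case (Suc j)
  show ?case
  proof (cases "i = Suc j")
    case False
    then have "(P ^^ j) A \<subseteq> (P ^^ i) A" using Suc by auto
    moreover have "P ((P ^^ j) A) \<subseteq> (P ^^ j) A" using Suc P_sub Pn_in by blast
    ultimately show ?thesis by auto
  qed auto
qed auto

lemma Pn_sub: "A \<in> G \<Longrightarrow> (P ^^ j) A \<subseteq> A"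
  using Pn_antimono[of A 0 j] by simp

lemma Pn_card_antimono: "A \<in> G \<Longrightarrow> i \<le> j \<Longrightarrow> card ((P ^^ j) A) \<le> card ((P ^^ i) A)"
  by (meson Pn_antimono Pn_in card_mono finite_member)

lemma Pn_gap: "A \<in> G \<Longrightarrow> card (A - (P ^^ i) A) \<le> i * g"
proof (induction i)
  case (Suc i)
  have "A - (P ^^ Suc i) A \<subseteq> (A - (P ^^ i) A) \<union> ((P ^^ i) A - P ((P ^^ i) A))" by auto
  then have "card (A - (P ^^ Suc i) A) \<le> card ((A - (P ^^ i) A) \<union> ((P ^^ i) A - P ((P ^^ i) A)))"
    using Suc finite_member Pn_in by (intro card_mono) auto
  also have "\<dots> \<le> i * g + g"
    using Suc P_gap[OF Pn_in[OF Suc(2), of i]] by (intro order_trans[OF card_Un_le] add_mono) auto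
  finally show ?case by simp
qed auto

text \<open>The sets other than \<open>B\<close> with predecessor \<open>B\<close> all contain the
  nonempty \<open>B\<close>. If one lay below another, \<open>P_max\<close> would bound its size by
  that of its proper subset \<open>B\<close>. So they form an intersecting antichain, and
  \<open>B\<close> itself may add one more.\<close>

lemma P_fibre: "card {A \<in> G. P A = B} \<le> k"
proof (cases "B \<in> G")
  case True
  let ?S = "{A \<in> G. P A = B} - {B}"
  have "card ?S < k"
  proof (rule antichain_card_less)
    fix A A' assume *: "A \<in> ?S" "A' \<in> ?S"
    have "B \<noteq> {}" using True G_ne by auto
    moreover have "B \<subseteq> A" "B \<subseteq> A'" using * P_sub by blast+
    ultimately show "A \<inter> A' \<noteq> {}" by auto
    show "\<not> A \<subset> A'"
    proof
      assume "A \<subset> A'"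
      then have "card A \<le> card B" using * P_max[of A' A] by auto
      moreover have "B \<subset> A" using * \<open>B \<subseteq> A\<close> by auto
      ultimately show False using psubset_card_mono[of A B] finite_member * by auto
    qed
  qed auto
  moreover have "card {A \<in> G. P A = B} \<le> card (insert B ?S)"
    using finite_G by (intro card_mono) auto
  ultimately show ?thesis using card_insert_le_m1[of "Suc (card ?S)" ?S B] by simp
next
  case False
  then have "{A \<in> G. P A = B} = {}" using P_in by auto
  then show ?thesis by (metis card.empty le0)
qed

lemma card_P_vimage:
  assumes "finite T" shows "card {A \<in> G. P A \<in> T} \<le> k * card T"
proof (rule card_le_fibres[OF assms])
  fix b assume "b \<in> T"
  have "card {a \<in> {A \<in> G. P A \<in> T}. P a = b} \<le> card {A \<in> G. P A = b}"
    using finite_G by (intro card_mono) auto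
  then show "card {a \<in> {A \<in> G. P A \<in> T}. P a = b} \<le> k" using P_fibre[of b] by linarith
qed auto

lemma card_Pn_vimage:
  assumes "finite T" shows "card {A \<in> G. (P ^^ i) A \<in> T} \<le> k ^ i * card T"
  using assms
proof (induction i arbitrary: T)
  case 0
  then show ?case by (auto intro!: card_mono)
next
  case (Suc i)
  have "{A \<in> G. (P ^^ Suc i) A \<in> T} = {A \<in> G. (P ^^ i) A \<in> {A \<in> G. P A \<in> T}}"
    using Pn_in by auto
  then have "card {A \<in> G. (P ^^ Suc i) A \<in> T} \<le> k ^ i * card {A \<in> G. P A \<in> T}"
    using Suc(1)[of "{A \<in> G. P A \<in> T}"] finite_G by auto
  also have "\<dots> \<le> k ^ i * (k * card T)" using card_P_vimage[OF Suc(2)] by simp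
  finally show ?case by (simp add: mult_ac)
qed

text \<open>Each application of \<open>P\<close> loses at most \<open>g\<close> elements, so the two
  iterates together miss at most \<open>2 * d * g\<close> elements of \<open>A\<close>, fewer than
  \<open>A\<close> has.\<close>

lemma Pn_inter:
  assumes "A \<in> G" "B \<in> G" "A \<subseteq> B" "i \<le> d" "j \<le> d" "2 * d * g < s"
  shows "(P ^^ i) A \<inter> (P ^^ j) B \<noteq> {}"
proof
  assume "(P ^^ i) A \<inter> (P ^^ j) B = {}"
  then have "A \<subseteq> (A - (P ^^ i) A) \<union> (B - (P ^^ j) B)" using assms(3) by auto
  then have "card A \<le> card ((A - (P ^^ i) A) \<union> (B - (P ^^ j) B))"
    using assms finite_member by (intro card_mono) auto
  also have "\<dots> \<le> i * g + j * g"
    using Pn_gap assms by (intro order_trans[OF card_Un_le] add_mono) auto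
  also have "\<dots> \<le> d * g + d * g" using assms by (intro add_mono mult_right_mono) auto
  finally show False using assms size_ge[of A] by auto
qed

lemma Pn_inter_comparable:
  assumes "A \<in> G" "B \<in> G" "A \<subseteq> B \<or> B \<subseteq> A" "i \<le> d" "j \<le> d" "2 * d * g < s"
  shows "(P ^^ i) A \<inter> (P ^^ j) B \<noteq> {}"
  using Pn_inter[of A B i d j] Pn_inter[of B A j d i] assms by blast

text \<open>By induction on \<^term>\<open>d\<close>: a member of \<^term>\<open>X\<close> lying above another one keeps the minimal size
  after one application of \<^term>\<open>P\<close>, and the minimal members form an antichain.\<close>

lemma card_exceptional:
  assumes "X \<subseteq> G" "\<And>A. A \<in> X \<Longrightarrow> t \<le> card A"
    and "\<And>A B i j. A \<in> X \<Longrightarrow> B \<in> X \<Longrightarrow> i \<le> d \<Longrightarrow> j \<le> d \<Longrightarrow> (P ^^ i) A \<inter> (P ^^ j) B \<noteq> {}"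
  shows "card {A \<in> X. card ((P ^^ d) A) < t} \<le> exc k d"
  using assms
proof (induction d arbitrary: X)
  case 0
  then have "{A \<in> X. card ((P ^^ 0) A) < t} = {}" by (auto simp: not_less)
  then show ?case by (simp only: card.empty exc.simps)
next
  case (Suc d)
  define M where "M = {A \<in> X. \<forall>B\<in>X. \<not> B \<subset> A}"
  define Y where "Y = P ` (X - M)"
  have finX: "finite X" using Suc(2) finite_G finite_subset by blast
  have M: "card M < k"
    by (rule antichain_card_less) (use Suc(2) Suc(4)[of _ _ 0 0] in \<open>auto simp: M_def\<close>)
  have "card {A \<in> Y. card ((P ^^ d) A) < t} \<le> exc k d"
  proof (rule Suc.IH)
    show "Y \<subseteq> G" using Suc(2) P_in by (auto simp: Y_def)
    show "t \<le> card A" if "A \<in> Y" for A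
    proof -
      obtain A' B where "A' \<in> X" "B \<in> X" "B \<subset> A'" "A = P A'"
        using \<open>A \<in> Y\<close> unfolding Y_def M_def by blast
      moreover from this have "card B \<le> card (P A')" using Suc(2) by (intro P_max) auto
      ultimately show ?thesis using Suc(3)[of B] by simp
    qed
    show "(P ^^ i) A \<inter> (P ^^ j) B \<noteq> {}" if "A \<in> Y" "B \<in> Y" "i \<le> d" "j \<le> d" for A B i j
    proof -
      obtain A' B' where "A' \<in> X" "B' \<in> X" "A = P A'" "B = P B'" using \<open>A \<in> Y\<close> \<open>B \<in> Y\<close> by (auto simp: Y_def)
      \<comment> \<open>The application of \<open>P\<close> that leads from \<open>X\<close> to
        \<open>Y\<close> uses up one unit of the depth for which intersections are assumed.\<close>
      then show ?thesis using Suc(4)[of A' B' "Suc i" "Suc j"] that by (simp add: funpow_swap1)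
    qed
  qed
  moreover have "{A \<in> X. card ((P ^^ Suc d) A) < t} \<subseteq> M \<union> {A \<in> G. P A \<in> {A \<in> Y. card ((P ^^ d) A) < t}}"
    using Suc(2) by (auto simp: Y_def funpow_swap1)
  then have "card {A \<in> X. card ((P ^^ Suc d) A) < t} \<le> card (M \<union> {A \<in> G. P A \<in> {A \<in> Y. card ((P ^^ d) A) < t}})"
    using finX finite_G by (intro card_mono) (auto simp: M_def)
  moreover have "\<dots> \<le> card M + card {A \<in> G. P A \<in> {A \<in> Y. card ((P ^^ d) A) < t}}"
    by (rule card_Un_le)
  moreover have "card {A \<in> G. P A \<in> {A \<in> Y. card ((P ^^ d) A) < t}} \<le> k * card {A \<in> Y. card ((P ^^ d) A) < t}"
    using finX by (intro card_P_vimage) (auto simp: Y_def)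
  moreover have "k * card {A \<in> Y. card ((P ^^ d) A) < t} \<le> k * exc k d"
    using calculation(1) by simp
  ultimately show ?case using M unfolding exc.simps by linarith
qed

text \<open>Greedy choice: take a smallest set \<open>A\<close>, discard it together with the at
  most \<open>exc k d\<close> sets whose \<open>d\<close>-th iterate is smaller than
  \<open>A\<close>, and repeat. Each round costs at most \<open>Suc (exc k d)\<close> sets.\<close>

lemma ex_spread_sequence:
  assumes "X \<subseteq> G" "r * Suc (exc k d) \<le> card X"
    and "\<And>A B i j. A \<in> X \<Longrightarrow> B \<in> X \<Longrightarrow> i \<le> d \<Longrightarrow> j \<le> d \<Longrightarrow> (P ^^ i) A \<inter> (P ^^ j) B \<noteq> {}"
  shows "\<exists>f. (\<forall>p<r. f p \<in> X) \<and> (\<forall>q<r. \<forall>p<q. card (f p) \<le> card ((P ^^ d) (f q)))"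
  using assms
proof (induction r arbitrary: X)
  case (Suc r)
  have finX: "finite X" using Suc(2) finite_G finite_subset by blast
  have "X \<noteq> {}" using Suc(3) by auto
  then obtain A where A: "A \<in> X" "\<And>B. B \<in> X \<Longrightarrow> card A \<le> card B"
    using ex_has_least_nat[of "\<lambda>B. B \<in> X" _ card] by blast
  define E where "E = {B \<in> X. card ((P ^^ d) B) < card A}"
  have E: "card E \<le> exc k d" unfolding E_def using Suc(2,4) A by (intro card_exceptional) auto
  have "card X \<le> card ((X - insert A E) \<union> insert A E)"
    using finX by (intro card_mono) (auto simp: E_def)
  also have "\<dots> \<le> card (X - insert A E) + card (insert A E)" by (rule card_Un_le)
  finally have "card X \<le> card (X - insert A E) + card (insert A E)" .
  moreover have "card (insert A E) \<le> Suc (exc k d)" using E card_insert_le_m1[of "Suc (card E)" E A] by simp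
  ultimately have "r * Suc (exc k d) \<le> card (X - insert A E)" using Suc(3) by simp
  then have "\<exists>f. (\<forall>p<r. f p \<in> X - insert A E) \<and> (\<forall>q<r. \<forall>p<q. card (f p) \<le> card ((P ^^ d) (f q)))"
    by (intro Suc.IH) (use Suc(2,4) in auto)
  then obtain f where f: "\<forall>p<r. f p \<in> X - insert A E"
    "\<forall>q<r. \<forall>p<q. card (f p) \<le> card ((P ^^ d) (f q))" by blast
  define h where "h = case_nat A f"
  have "h p \<in> X" if "p < Suc r" for p using that f A by (cases p) (auto simp: h_def)
  moreover have "card (h p) \<le> card ((P ^^ d) (h q))" if "p < q" "q < Suc r" for p q
  proof -
    obtain q' where q': "q = Suc q'" "q' < r" using \<open>p < q\<close> \<open>q < Suc r\<close> by (cases q) auto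
    show ?thesis
    proof (cases p)
      case 0
      have "f q' \<in> X - insert A E" using f q' by auto
      then show ?thesis using 0 q' by (auto simp: h_def E_def not_less)
    next
      case (Suc p')
      then show ?thesis using f(2) q' \<open>p < q\<close> by (auto simp: h_def)
    qed
  qed
  ultimately show ?case by blast
qed auto

text \<open>Since \<^term>\<open>(P ^^ a) X\<close> is not counted, a star of order \<^term>\<open>k - 1\<close> gives \<^term>\<open>k\<close> pairwise weakly
  crossing sets. The size condition refers to \<^term>\<open>X\<close> instead of \<^term>\<open>(P ^^ a) X\<close> to let the induction on
  the order pass to larger values of \<^term>\<open>a\<close>.\<close>

definition star :: "nat \<Rightarrow> nat \<Rightarrow> 'a set \<Rightarrow> 'a set set \<Rightarrow> bool" where
  "star l a X S \<longleftrightarrow> S \<subseteq> G \<and> card S = l \<and> (P ^^ a) X \<notin> S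
     \<and> pairwise weakly_crossing (insert ((P ^^ a) X) S)
     \<and> (\<forall>A\<in>S. card X \<le> card A \<and> (P ^^ (a + k ^ l)) X \<subseteq> A)"

definition starless :: "nat \<Rightarrow> nat \<Rightarrow> 'a set set" where
  "starless l a = {X \<in> G. \<not> (\<exists>S. star l a X S)}"

subsection \<open>Growing stars\<close>

text \<open>The element \<open>y\<close> separates the sets kept from \<open>S\<close> from those
  kept from \<open>T\<close>. By \<open>sub\<close> the latter contain the centre of
  \<open>S\<close>, which no member of \<open>S\<close> contains, so the two kinds are incomparable.
  The new centre \<open>(P ^^ a) X\<close> contains \<open>y\<close> and is no larger than any
  member, which rules out both inclusions.\<close>

lemma star_extend:
  assumes "X \<in> G" "Y \<in> G" and p: "1 \<le> p" "p < k" and m: "m = k ^ l"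
    and y: "y \<in> (P ^^ a) X" "y \<notin> (P ^^ Suc a) X" "y \<notin> (P ^^ Suc a) Y"
    and S: "star l (a + p * m) X S" and T: "star l (a + p * m) Y T"
    and eq: "card {A \<in> S. y \<in> A} = card {A \<in> T. y \<in> A}"
    and sub: "(P ^^ (a + p * m)) X \<subseteq> (P ^^ (a + Suc p * m)) Y"
    and size: "card X \<le> card ((P ^^ (a + k * m)) Y)"
  shows "star (Suc l) a X (insert ((P ^^ (a + p * m)) Y) ({A \<in> S. y \<in> A} \<union> {A \<in> T. y \<notin> A}))"
proof -
  define H F H' where "H = (P ^^ (a + p * m)) X" and "F = (P ^^ a) X" and "H' = (P ^^ (a + p * m)) Y"
  define S1 T1 where "S1 = {A \<in> S. y \<in> A}" and "T1 = insert H' {A \<in> T. y \<notin> A}"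
  \<comment> \<open>\<open>L\<close> lies below the new centre and every member of the new star, so
    all of them meet.\<close>
  define L where "L = (P ^^ (a + Suc p * m)) X"
  have "m \<ge> 1" using p m by simp
  \<comment> \<open>With \<open>p\<close> positive, the depth \<open>a + p * m\<close> lies beyond
    the level at which \<open>X\<close> and \<open>Y\<close> have lost \<open>y\<close>.\<close>
  then have "1 \<le> p * m" using p by simp
  then have pm: "Suc a \<le> a + p * m" by simp
  have "Suc p * m \<le> k * m" using p by (intro mult_right_mono) auto
  then have km: "a + Suc p * m \<le> a + k * m" by simp
  \<comment> \<open>The slack \<open>k ^ l\<close> in stars of order \<open>l\<close> is one step of
    length \<open>m\<close>. At most \<open>k\<close> such steps make up the slack
    \<open>k ^ Suc l\<close> of the new star.\<close>
  have depth: "a + p * m + k ^ l = a + Suc p * m" using m by simp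
  have LG: "L \<in> G" using assms(1) Pn_in by (simp add: L_def)
  then have "L \<noteq> {}" using G_ne by auto
  have LH: "L \<subseteq> H" unfolding L_def H_def by (intro Pn_antimono assms) auto
  have HF: "H \<subseteq> F" unfolding F_def H_def by (intro Pn_antimono assms) auto
  have FX: "card F \<le> card X" unfolding F_def using assms(1) by (intro card_mono Pn_sub finite_member)
  have finF: "finite F" unfolding F_def using assms(1) Pn_in finite_member by blast
  have yH: "y \<notin> H" using Pn_antimono[OF assms(1) pm] y by (auto simp: H_def)
  have yH': "y \<notin> H'" using Pn_antimono[OF assms(2) pm] y by (auto simp: H'_def)
  have yF: "y \<in> F" using y by (simp add: F_def)
  have S': "S \<subseteq> G" "card S = l" "H \<notin> S" "pairwise weakly_crossing (insert H S)"
    "\<And>A. A \<in> S \<Longrightarrow> card X \<le> card A" "\<And>A. A \<in> S \<Longrightarrow> L \<subseteq> A"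
    using S unfolding star_def H_def L_def depth by auto
  have T': "T \<subseteq> G" "card T = l" "H' \<notin> T" "pairwise weakly_crossing (insert H' T)"
    "\<And>A. A \<in> T \<Longrightarrow> (P ^^ (a + Suc p * m)) Y \<subseteq> A"
    using T unfolding star_def H'_def depth by auto
  have finS: "finite S" "finite T" using S' T' finite_G finite_subset by blast+
  have yS1: "y \<in> A" if "A \<in> S1" for A using that by (simp add: S1_def)
  have yT1: "y \<notin> A" if "A \<in> T1" for A using that yH' by (auto simp: T1_def)
  have T1G: "T1 \<subseteq> G" using T' assms(2) Pn_in by (auto simp: T1_def H'_def)
  have S1G: "S1 \<subseteq> G" using S' by (auto simp: S1_def)
  have LS1: "L \<subseteq> A" if "A \<in> S1" for A using that S' by (simp add: S1_def)
  have YT1: "(P ^^ (a + Suc p * m)) Y \<subseteq> A" if "A \<in> T1" for A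
    using that T' Pn_antimono[OF assms(2), of "a + p * m" "a + Suc p * m"] by (auto simp: T1_def H'_def)
  have HT1: "H \<subseteq> A" if "A \<in> T1" for A
    using that YT1 sub unfolding H_def by blast
  have sizeT1: "card X \<le> card A" if "A \<in> T1" for A
  proof -
    have "card X \<le> card ((P ^^ (a + k * m)) Y)" by (fact size)
    also have "\<dots> \<le> card ((P ^^ (a + Suc p * m)) Y)" using assms(2) km by (rule Pn_card_antimono)
    also have "\<dots> \<le> card A" using YT1[OF that] T1G that by (intro card_mono finite_member) auto
    finally show ?thesis .
  qed
  have HS1: "\<not> H \<subseteq> A" if "A \<in> S1" for A
  proof -
    have "A \<in> S" "A \<noteq> H" using that S'(3) by (auto simp: S1_def)
    then have "weakly_crossing H A" using S'(4) by (simp add: pairwise_insert)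
    then show ?thesis by (simp add: weakly_crossing_def)
  qed
  have no_sub: "\<not> A \<subseteq> F" if "card X \<le> card A" "A \<noteq> F" for A
    using that FX finF card_seteq[of F A] by auto
  have wcS1: "pairwise weakly_crossing S1" "pairwise weakly_crossing T1"
    by (rule pairwise_subset[OF S'(4)], force simp: S1_def)
      (rule pairwise_subset[OF T'(4)], force simp: T1_def)
  have FS1: "weakly_crossing F A" if "A \<in> S1" for A
  proof -
    have "F \<noteq> A" "\<not> F \<subseteq> A" using HS1[OF that] HF by auto
    moreover have "card X \<le> card A" using that S' by (simp add: S1_def)
    ultimately show ?thesis using no_sub[of A] LS1[OF that] LH HF \<open>L \<noteq> {}\<close>
      unfolding weakly_crossing_def by blast
  qed
  have FT1: "weakly_crossing F A" if "A \<in> T1" for A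
    using no_sub[of A] sizeT1[OF that] yT1[OF that] yF HT1[OF that] HF LH \<open>L \<noteq> {}\<close>
    unfolding weakly_crossing_def by blast
  have ST: "weakly_crossing A B" if "A \<in> S1" "B \<in> T1" for A B
    using yS1[OF that(1)] yT1[OF that(2)] HT1[OF that(2)] HS1[OF that(1)] LS1[OF that(1)] LH \<open>L \<noteq> {}\<close>
    unfolding weakly_crossing_def by blast
  have "weakly_crossing A B" if "A \<in> S1 \<union> T1" "B \<in> S1 \<union> T1" "A \<noteq> B" for A B
    using that wcS1 ST[of A B] ST[of B A] unfolding pairwise_def by (auto simp: weakly_crossing_commute)
  then have "pairwise weakly_crossing (S1 \<union> T1)" by (intro pairwiseI)
  moreover have "weakly_crossing F A \<and> weakly_crossing A F" if "A \<in> S1 \<union> T1" for A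
    using that FS1[of A] FT1[of A] weakly_crossing_commute[of A F] by blast
  ultimately have wc: "pairwise weakly_crossing (insert F (S1 \<union> T1))"
    by (simp add: pairwise_insert)
  \<comment> \<open>By \<open>eq\<close>, the members of \<open>S\<close> containing
    \<open>y\<close> replace equally many members of \<open>T\<close>, which gives \<open>l\<close>
    sets; \<open>H'\<close> is the additional one.\<close>
  have "card (S1 \<union> T1) = card S1 + card T1"
  proof (rule card_Un_disjoint)
    show "S1 \<inter> T1 = {}" using yS1 yT1 by blast
  qed (use finS in \<open>simp_all add: S1_def T1_def\<close>)
  moreover have "card T1 = Suc (card {A \<in> T. y \<notin> A})"
    unfolding T1_def using T'(3) finS by (subst card_insert_disjoint) auto
  moreover have "card T = card {A \<in> T. y \<notin> A} + card {A \<in> T. y \<in> A}"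
  proof -
    have "T = {A \<in> T. y \<notin> A} \<union> {A \<in> T. y \<in> A}" by auto
    moreover have "card ({A \<in> T. y \<notin> A} \<union> {A \<in> T. y \<in> A}) = card {A \<in> T. y \<notin> A} + card {A \<in> T. y \<in> A}"
      using finS by (intro card_Un_disjoint) auto
    ultimately show ?thesis by simp
  qed
  ultimately have card: "card (S1 \<union> T1) = Suc l"
    using eq T'(2) by (simp add: S1_def)
  have low: "(P ^^ (a + k ^ Suc l)) X \<subseteq> A" if "A \<in> S1 \<union> T1" for A
  proof -
    have "(P ^^ (a + k ^ Suc l)) X \<subseteq> L" unfolding L_def using km m by (intro Pn_antimono assms) simp
    then show ?thesis using that LS1 HT1 LH by blast
  qed
  have "F \<notin> S1 \<union> T1" using FS1 FT1 unfolding weakly_crossing_def by blast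
  then have "star (Suc l) a X (S1 \<union> T1)"
    unfolding star_def F_def[symmetric]
  proof (intro conjI ballI)
    show "S1 \<union> T1 \<subseteq> G" using S1G T1G by simp
    show "card X \<le> card A" if "A \<in> S1 \<union> T1" for A
      using that sizeT1 S'(5) by (auto simp: S1_def)
  qed (use card wc low in simp_all)
  moreover have "S1 \<union> T1 = insert H' ({A \<in> S. y \<in> A} \<union> {A \<in> T. y \<notin> A})"
    by (auto simp: S1_def T1_def)
  ultimately show ?thesis by (simp add: H'_def)
qed

text \<open>Otherwise the sets \<open>(P ^^ (a + p * m)) (f p)\<close> for \<open>p < k\<close>
  would cross weakly in pairs: for \<open>p < q\<close> the iterate of \<open>f q\<close> lies
  deeper by at least \<open>m\<close>, so failure of nesting excludes one inclusion, and
  \<open>size\<close> then excludes the other. Comparability and the bound on \<open>g\<close> make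
  them meet.\<close>

lemma ex_nested_pair:
  assumes "\<And>p. p < k \<Longrightarrow> f p \<in> G" and m: "m \<ge> 1"
    and comp: "\<And>p q. p < k \<Longrightarrow> q < k \<Longrightarrow> f p \<subseteq> f q \<or> f q \<subseteq> f p"
    and size: "\<And>p q. p < q \<Longrightarrow> q < k \<Longrightarrow> card (f p) \<le> card ((P ^^ (a + k * m)) (f q))"
    and g: "2 * (a + k * m) * g < s"
  shows "\<exists>p q. p < q \<and> q < k \<and> (P ^^ (a + p * m)) (f p) \<subseteq> (P ^^ (a + Suc p * m)) (f q)"
proof (rule ccontr)
  assume neg: "\<not> ?thesis"
  define h where "h p = (P ^^ (a + p * m)) (f p)" for p
  have le: "a + q * m \<le> a + k * m" if "q < k" for q
    using that by simp
  have wc: "weakly_crossing (h p) (h q)" if "p < q" "q < k" for p q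
  proof -
    have "p < k" using that by simp
    have fin: "finite (h p)" using assms(1) Pn_in \<open>p < k\<close> finite_member by (simp add: h_def)
    have "Suc p * m \<le> q * m" using that by (intro mult_right_mono) auto
    then have "h q \<subseteq> (P ^^ (a + Suc p * m)) (f q)"
      unfolding h_def using assms(1) that by (intro Pn_antimono) auto
    then have 1: "\<not> h p \<subseteq> h q" using neg that unfolding h_def by blast
    have "card (h p) \<le> card (f p)"
      unfolding h_def using assms(1) \<open>p < k\<close> by (intro card_mono Pn_sub finite_member) auto
    also have "\<dots> \<le> card ((P ^^ (a + k * m)) (f q))" using size that by blast
    also have "\<dots> \<le> card (h q)"
      unfolding h_def using assms(1) that le by (intro Pn_card_antimono) auto
    finally have 2: "\<not> h q \<subseteq> h p" using 1 card_seteq[OF fin, of "h q"] by auto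
    have 3: "h p \<inter> h q \<noteq> {}"
      unfolding h_def
      by (rule Pn_inter_comparable[OF _ _ comp _ _ g]) (use assms(1) that \<open>p < k\<close> in auto)
    show ?thesis using 1 2 3 by (simp add: weakly_crossing_def)
  qed
  have inj: "inj_on h {..<k}"
  proof (rule linorder_inj_onI)
    show "h p \<noteq> h q" if "p < q" "p \<in> {..<k}" "q \<in> {..<k}" for p q
      using wc[of p q] that by (auto simp: weakly_crossing_def)
  qed auto
  have "pairwise weakly_crossing (h ` {..<k})"
  proof (rule pairwise_imageI)
    show "weakly_crossing (h p) (h q)" if "p \<in> {..<k}" "q \<in> {..<k}" "p \<noteq> q" for p q
      using wc[of p q] wc[of q p] that weakly_crossing_commute by (cases "p < q") auto
  qed
  then have "card (h ` {..<k}) < k"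
    using assms(1) Pn_in by (intro card_pairwise_less) (auto simp: h_def)
  then show False using card_image[OF inj] by simp
qed

text \<open>All sets in \<open>B\<close> contain \<open>y\<close>, so an antichain in
  \<open>B\<close> has fewer than \<open>k\<close> members and Ramsey's theorem yields a long chain.
  Its length allows for \<open>Suc l ^ k\<close> profiles of stars and then a spread sequence of
  length \<open>k\<close>. A nested pair in that sequence extends to a star of order
  \<open>Suc l\<close>, a contradiction.\<close>

lemma starless_fibre_bound:
  assumes "k \<ge> 1" and m: "m = k ^ l" and D: "D = a + k * m" and g: "2 * D * g < s"
    and ram: "\<And>(V::'a set set) (E::'a set set set). finite V \<Longrightarrow> r \<le> card V \<Longrightarrow>
      \<exists>R\<subseteq>V. card R = Suc (k * Suc (exc k D) * Suc l ^ k) \<and> clique R E \<or> card R = k \<and> indep R E"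
    and B: "B \<subseteq> starless (Suc l) a"
    and y: "\<And>X. X \<in> B \<Longrightarrow> y \<in> (P ^^ a) X \<and> y \<notin> (P ^^ Suc a) X"
    and stars: "\<And>X p. X \<in> B \<Longrightarrow> p < k \<Longrightarrow> X \<notin> starless l (a + p * m)"
  shows "card B < r"
proof (rule ccontr)
  assume "\<not> card B < r"
  have BG: "B \<subseteq> G" using B by (auto simp: starless_def)
  then have finB: "finite B" using finite_G finite_subset by blast
  \<comment> \<open>Edges join comparable sets: cliques are chains and independent sets are
    antichains.\<close>
  define E :: "'a set set set" where "E = {{A, A'} | A A'. A \<subset> A'}"
  obtain R where R: "R \<subseteq> B"
    "card R = Suc (k * Suc (exc k D) * Suc l ^ k) \<and> clique R E \<or> card R = k \<and> indep R E"
    using ram[OF finB] \<open>\<not> card B < r\<close> by (meson not_less)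
  have yB: "y \<in> X" if "X \<in> B" for X using y[OF that] Pn_sub[of X a] BG that by auto
  have "\<not> (card R = k \<and> indep R E)"
  proof
    assume *: "card R = k \<and> indep R E"
    have "card R < k"
    proof (rule antichain_card_less)
      show "\<not> A \<subset> A'" if "A \<in> R" "A' \<in> R" for A A'
        using that * unfolding indep_def E_def by blast
      show "A \<inter> A' \<noteq> {}" if "A \<in> R" "A' \<in> R" for A A'
        using yB that R(1) by blast
    qed (use R BG in auto)
    then show False using * by simp
  qed
  then have cardR: "card R = Suc (k * Suc (exc k D) * Suc l ^ k)" and cl: "clique R E" using R by auto
  have comp: "A \<subseteq> A' \<or> A' \<subseteq> A" if "A \<in> R" "A' \<in> R" for A A'
    using cl that unfolding clique_def E_def by (cases "A = A'") (auto simp: doubleton_eq_iff)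
  have "\<forall>X\<in>B. \<forall>p. \<exists>S. p < k \<longrightarrow> star l (a + p * m) X S"
    using stars BG by (auto simp: starless_def)
  then obtain S where S: "\<And>X p. X \<in> B \<Longrightarrow> p < k \<Longrightarrow> star l (a + p * m) X (S X p)" by metis
  \<comment> \<open>Which depth index \<open>p\<close> will be used is known only after the nested
    pair is found, so the counts for all \<open>p < k\<close> are equalized in advance.\<close>
  define \<nu> where "\<nu> X = restrict (\<lambda>p. card {A \<in> S X p. y \<in> A}) {..<k}" for X
  have "\<nu> X \<in> {..<k} \<rightarrow>\<^sub>E {..l}" if "X \<in> R" for X
  proof -
    have "card {A \<in> S X p. y \<in> A} \<le> l" if "p < k" for p
    proof -
      have *: "S X p \<subseteq> G" "card (S X p) = l" using S[of X p] \<open>X \<in> R\<close> R that by (auto simp: star_def)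
      then have "card {A \<in> S X p. y \<in> A} \<le> card (S X p)" 
        using finite_G finite_subset by (intro card_mono) auto
      with * show ?thesis by simp
    qed
    then show ?thesis by (auto simp: \<nu>_def)
  qed
  then have img: "\<nu> ` R \<subseteq> {..<k} \<rightarrow>\<^sub>E {..l}" by blast
  have "card ({..<k} \<rightarrow>\<^sub>E {..l}) = Suc l ^ k" by (simp add: card_PiE)
  then obtain v where v: "k * Suc (exc k D) < card {X \<in> R. \<nu> X = v}"
    using ex_large_fibre[of "{..<k} \<rightarrow>\<^sub>E {..l}" \<nu> R "k * Suc (exc k D)"] img cardR
    by (auto simp: finite_PiE)
  define R' where "R' = {X \<in> R. \<nu> X = v}"
  have R': "R' \<subseteq> R" "R' \<subseteq> B" "R' \<subseteq> G" using R BG by (auto simp: R'_def)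
  have "\<exists>f. (\<forall>p<k. f p \<in> R') \<and> (\<forall>q<k. \<forall>p<q. card (f p) \<le> card ((P ^^ D) (f q)))"
  proof (rule ex_spread_sequence)
    show "(P ^^ i) A \<inter> (P ^^ j) A' \<noteq> {}" if "A \<in> R'" "A' \<in> R'" "i \<le> D" "j \<le> D" for A A' i j
    proof (rule Pn_inter_comparable[OF _ _ _ _ _ g])
      show "A \<subseteq> A' \<or> A' \<subseteq> A" using comp that R' by blast
    qed (use that R' in auto)
  qed (use v R' in \<open>auto simp: R'_def\<close>)
  then obtain f where f: "\<And>p. p < k \<Longrightarrow> f p \<in> R'"
    "\<And>p q. p < q \<Longrightarrow> q < k \<Longrightarrow> card (f p) \<le> card ((P ^^ D) (f q))" by blast
  have m1: "m \<ge> 1" using m assms(1) by simp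
  have "\<exists>p q. p < q \<and> q < k \<and> (P ^^ (a + p * m)) (f p) \<subseteq> (P ^^ (a + Suc p * m)) (f q)"
  proof (rule ex_nested_pair[OF _ m1])
    show "f p \<subseteq> f q \<or> f q \<subseteq> f p" if "p < k" "q < k" for p q
      using comp f(1)[OF that(1)] f(1)[OF that(2)] R' by blast
  qed (use f R' g D in auto)
  then obtain p q where pq: "p < q" "q < k"
    "(P ^^ (a + p * m)) (f p) \<subseteq> (P ^^ (a + Suc p * m)) (f q)" by blast
  have fp: "f p \<in> R'" "f q \<in> R'" using f pq by auto
  then have fG: "f p \<in> G" "f q \<in> G" "f p \<in> B" "f q \<in> B" using R' by auto
  \<comment> \<open>For \<open>p = 0\<close> the nesting would carry \<open>y\<close> into an
    iterate of \<open>f q\<close> that has already lost it.\<close>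
  have "p \<ge> 1"
  proof (rule ccontr)
    assume "\<not> p \<ge> 1"
    then have "p = 0" by simp
    then have "y \<in> (P ^^ (a + m)) (f q)" using pq(3) y[OF fG(3)] by auto
    moreover have "(P ^^ (a + m)) (f q) \<subseteq> (P ^^ Suc a) (f q)" using m1 fG by (intro Pn_antimono) auto
    ultimately show False using y[OF fG(4)] by auto
  qed
  have "\<nu> (f p) p = \<nu> (f q) p" using fp by (simp add: R'_def)
  then have "card {A \<in> S (f p) p. y \<in> A} = card {A \<in> S (f q) p. y \<in> A}"
    using pq by (simp add: \<nu>_def)
  moreover have "p < k" "card (f p) \<le> card ((P ^^ (a + k * m)) (f q))"
    using pq f(2)[OF pq(1,2)] D by auto
  ultimately have "star (Suc l) a (f p) (insert ((P ^^ (a + p * m)) (f q))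
      ({A \<in> S (f p) p. y \<in> A} \<union> {A \<in> S (f q) p. y \<notin> A}))"
    using y[OF fG(3)] y[OF fG(4)]
    by (intro star_extend[OF fG(1,2) \<open>p \<ge> 1\<close> _ m _ _ _ S[OF fG(3)] S[OF fG(4)] _ pq(3)]) simp_all
  then show False using B fG(3) unfolding starless_def by blast
qed

end

text \<open>Induction on the order, at all depths at once. A starless set of order
  \<open>Suc l\<close> is starless of order \<open>l\<close> at one of \<open>k\<close> depths, or
  has its \<open>a\<close>-th iterate in \<open>Q\<close>, or is charged to an element
  \<open>y\<close> lost in the next step. Both constants are chosen before the family.\<close>

lemma starless_bound:
  assumes "k \<ge> 1"
  shows "\<exists>C M. \<forall>(U::'a set) G P g s. pred_family k U G P g s \<longrightarrow> M * g < s \<longrightarrow>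
    card (pred_family.starless k G P l a) \<le> C * (card U + card (pred_family.Q G P))"
proof (induction l arbitrary: a)
  case 0
  show ?case
  proof (intro exI[of _ 0] allI impI)
    fix U :: "'a set" and G P g s
    assume "pred_family k U G P g s"
    then interpret pred_family k U G P g s .
    have "starless 0 a = {}"
      unfolding starless_def star_def by (auto intro!: exI[of _ "{}"])
    then show "card (starless 0 a) \<le> 0 * (card U + card Q)" by simp
  qed
next
  case (Suc l)
  define m D where "m = k ^ l" and "D = a + k * m"
  obtain C M where CM: "\<And>b (U::'a set) G P g s. pred_family k U G P g s \<Longrightarrow> M b * g < s \<Longrightarrow>
    card (pred_family.starless k G P l b) \<le> C b * (card U + card (pred_family.Q G P))"
    using Suc.IH by metis
  obtain r where ram: "\<And>(V::'a set set) (E::'a set set set). finite V \<Longrightarrow> r \<le> card V \<Longrightarrow>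
      \<exists>R\<subseteq>V. card R = Suc (k * Suc (exc k D) * Suc l ^ k) \<and> clique R E \<or> card R = k \<and> indep R E"
    using ramsey2 by metis
  \<comment> \<open>In the first constant, \<open>r\<close> bounds a fibre over \<open>y\<close>,
    \<open>k ^ a\<close> a fibre over \<open>Q\<close>, and the sum comes from the induction
    hypothesis. In the second, \<open>2 * D\<close> makes iterates of comparable sets meet up to
    depth \<open>D\<close>, and the sum covers the requirements of the induction hypothesis.\<close>
  show ?case
  proof (rule exI[of _ "r + k ^ a + (\<Sum>p<k. C (a + p * m))"],
      rule exI[of _ "2 * D + (\<Sum>p<k. M (a + p * m))"], intro allI impI)
    fix U :: "'a set" and G P g s
    assume "pred_family k U G P g s"
      and gs: "(2 * D + (\<Sum>p<k. M (a + p * m))) * g < s"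
    then interpret pred_family k U G P g s by simp
    have D: "2 * D * g < s" using gs by (simp add: add_mult_distrib)
    have M: "M (a + p * m) * g < s" if "p < k" for p
    proof -
      have "M (a + p * m) \<le> (\<Sum>p<k. M (a + p * m))" using that by (intro member_le_sum) auto
      then have "M (a + p * m) * g \<le> (2 * D + (\<Sum>p<k. M (a + p * m))) * g" by (intro mult_right_mono) auto
      then show ?thesis using gs by (rule le_less_trans)
    qed
    define z where "z F = (SOME y. y \<in> F - P F)" for F
    have z: "z F \<in> F - P F" if "F \<in> G" "F \<notin> Q" for F
    proof -
      have "\<exists>y. y \<in> F - P F" using that P_sub[of F] unfolding Q_def by blast
      then show ?thesis unfolding z_def by (rule someI_ex)
    qed
    define N where "N = (\<Union>p<k. starless l (a + p * m))"
    define T where "T = {X \<in> G. (P ^^ a) X \<in> Q}"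
    define B where "B = starless (Suc l) a - T - N"
    have fin: "finite (starless i b)" for i b using finite_G by (simp add: starless_def)
    have BG: "B \<subseteq> G" by (auto simp: B_def starless_def)
    have PB: "(P ^^ a) X \<in> G" "(P ^^ a) X \<notin> Q" if "X \<in> B" for X
      using that BG Pn_in by (auto simp: B_def T_def)
    have "card B \<le> r * card U"
    proof (rule card_le_fibres[OF finite_U])
      show "(\<lambda>X. z ((P ^^ a) X)) ` B \<subseteq> U"
        using z PB G_sub by blast
      fix y assume "y \<in> U"
      have "card {X \<in> B. z ((P ^^ a) X) = y} < r"
      proof (rule starless_fibre_bound[OF assms m_def D_def D ram])
        show "y \<in> (P ^^ a) X \<and> y \<notin> (P ^^ Suc a) X" if "X \<in> {X \<in> B. z ((P ^^ a) X) = y}" for X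
          using z[OF PB] that by auto
      qed (auto simp: B_def N_def)
      then show "card {X \<in> B. z ((P ^^ a) X) = y} \<le> r" by simp
    qed
    moreover have "card T \<le> k ^ a * card Q"
      unfolding T_def by (rule card_Pn_vimage[OF finite_Q])
    moreover have "card N \<le> (\<Sum>p<k. C (a + p * m)) * (card U + card Q)"
    proof -
      have "card N \<le> (\<Sum>p<k. card (starless l (a + p * m)))"
        unfolding N_def by (rule card_UN_le) simp
      also have "\<dots> \<le> (\<Sum>p<k. C (a + p * m) * (card U + card Q))"
        using CM[OF pred_family_axioms M] by (intro sum_mono) auto
      finally show ?thesis by (simp add: sum_distrib_right)
    qed
    moreover have "card (starless (Suc l) a) \<le> card B + card T + card N"
    proof -
      have "card (starless (Suc l) a) \<le> card (B \<union> T \<union> N)"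
        using fin finite_G by (intro card_mono) (auto simp: B_def T_def N_def)
      then show ?thesis using card_Un_le[of "B \<union> T" N] card_Un_le[of B T] by linarith
    qed
    ultimately show "card (starless (Suc l) a)
        \<le> (r + k ^ a + (\<Sum>p<k. C (a + p * m))) * (card U + card Q)"
      by (simp add: algebra_simps)
  qed
qed

text \<open>At depth 0 the centre is \<open>X\<close> itself. A star of order \<open>k - 1\<close>
  would complete it to \<open>k\<close> pairwise weakly crossing sets, so all of \<open>G\<close> is
  starless.\<close>

lemma pred_family_bound:
  assumes "k \<ge> 1"
  shows "\<exists>C M. \<forall>(U::'a set) G P g s. pred_family k U G P g s \<longrightarrow> M * g < s \<longrightarrow>
    card G \<le> C * (card U + card (pred_family.Q G P))"
proof -
  obtain C M where CM: "\<And>(U::'a set) G P g s. pred_family k U G P g s \<Longrightarrow> M * g < s \<Longrightarrow>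
    card (pred_family.starless k G P (k - 1) 0) \<le> C * (card U + card (pred_family.Q G P))"
    using starless_bound[OF assms, of "k - 1" 0] by blast
  show ?thesis
  proof (rule exI[of _ C], rule exI[of _ M], intro allI impI)
    fix U :: "'a set" and G P g s
    assume *: "pred_family k U G P g s" "M * g < s"
    then interpret pred_family k U G P g s by simp
    have "\<not> star (k - 1) 0 X S" if "X \<in> G" for X S
    proof
      assume S: "star (k - 1) 0 X S"
      then have "finite S" using finite_G finite_subset by (auto simp: star_def)
      then have "card (insert X S) = k" using S assms by (auto simp: star_def)
      moreover have "card (insert X S) < k"
        using S that by (intro card_pairwise_less) (auto simp: star_def)
      ultimately show False by simp
    qed
    then have "starless (k - 1) 0 = G" by (auto simp: starless_def)
    then show "card G \<le> C * (card U + card Q)" using CM[OF *] by simp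
  qed
qed


subsection \<open>Families with sizes in a bounded range\<close>

lemma (in weak_free) weak_free_subset: "G' \<subseteq> G \<Longrightarrow> weak_free k U G'"
  using finite_U G_sub G_ne card_pairwise_less by unfold_locales blast+

text \<open>Double counting: every set receives weight \<open>1 / card A\<close> from each of its
  elements, hence total weight 1.\<close>

lemma (in weak_free) card_eq_sum_inverse_card:
  assumes "T \<subseteq> G"
  shows "real (card T) = (\<Sum>x\<in>U. \<Sum>A\<in>{A \<in> T. x \<in> A}. 1 / real (card A))"
proof -
  have fin: "finite T" using assms finite_G finite_subset by blast
  have "(\<Sum>x\<in>{x \<in> U. x \<in> A}. 1 / real (card A)) = 1" if "A \<in> T" for A
  proof -
    have "{x \<in> U. x \<in> A} = A" using that assms G_sub by auto
    moreover have "card A > 0" using that assms G_ne finite_member[of A] by (auto simp: card_gt_0_iff)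
    ultimately show ?thesis by simp
  qed
  then have "(\<Sum>A\<in>T. \<Sum>x\<in>{x \<in> U. x \<in> A}. 1 / real (card A)) = (\<Sum>A\<in>T. 1)"
    by (intro sum.cong refl)
  then have "real (card T) = (\<Sum>A\<in>T. \<Sum>x\<in>{x \<in> U. x \<in> A}. 1 / real (card A))" by simp
  also have "\<dots> = (\<Sum>x\<in>U. \<Sum>A\<in>{A \<in> T. x \<in> A}. 1 / real (card A))"
    by (rule sum.swap_restrict[OF fin finite_U])
  finally show ?thesis .
qed

lemma sum_inverse_le: "n \<ge> 1 \<Longrightarrow> (\<Sum>j=1..n. 1 / real j) \<le> 1 + ln (real n)"
proof (induction n rule: nat_induct_at_least)
  case (Suc n)
  have "ln (real n / real (Suc n)) \<le> real n / real (Suc n) - 1"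
    using Suc by (intro ln_le_minus_one) simp
  moreover have "ln (real n / real (Suc n)) = ln (real n) - ln (real (Suc n))"
    using Suc by (intro ln_divide_pos) auto
  moreover have "real n / real (Suc n) - 1 = - (1 / real (Suc n))" by (simp add: field_simps)
  ultimately show ?case using Suc by simp
qed auto

text \<open>Among the sets through \<open>x\<close>, those with sizes in a window of length
  \<open>g\<close> form an antichain because of \<open>gap\<close>, so there are fewer than
  \<open>k\<close>. In window \<open>j\<close> each has weight at most \<open>1 / (g * j)\<close>,
  and a harmonic sum bounds the weight at \<open>x\<close>.\<close>

lemma (in weak_free) card_sparse_le:
  assumes T: "T \<subseteq> G" and g: "g \<ge> 1"
    and size: "\<And>A. A \<in> T \<Longrightarrow> g \<le> card A \<and> card A \<le> s"
    and gap: "\<And>A B. A \<in> T \<Longrightarrow> B \<in> T \<Longrightarrow> B \<subset> A \<Longrightarrow> g \<le> card (A - B)"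
    and s: "s \<ge> 1"
  shows "real (card T) \<le> real k * (1 + ln (real s)) / real g * real (card U)"
proof -
  have finT: "finite T" using T finite_G finite_subset by blast
  have "(\<Sum>A\<in>{A \<in> T. x \<in> A}. 1 / real (card A)) \<le> real k * (1 + ln (real s)) / real g" for x
  proof -
    define Tx where "Tx = {A \<in> T. x \<in> A}"
    have finTx: "finite Tx" using finT by (simp add: Tx_def)
    \<comment> \<open>The lower bound \<open>g\<close> on sizes excludes window 0, for which the
      estimate of the weights would fail.\<close>
    have pos: "1 \<le> card A div g" if "A \<in> Tx" for A
      using that size[of A] g div_le_mono[of g "card A" g] by (simp add: Tx_def)
    have window: "card {A \<in> Tx. card A div g = j} \<le> k" for j
    proof -
      have "card {A \<in> Tx. card A div g = j} < k"
      proof (rule antichain_card_less)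
        show "\<not> B \<subset> A" if B: "B \<in> {A \<in> Tx. card A div g = j}" and A: "A \<in> {A \<in> Tx. card A div g = j}" for A B
        proof
          assume "B \<subset> A"
          then have "g \<le> card (A - B)" using gap A B by (simp add: Tx_def)
          moreover have "card (A - B) = card A - card B"
            using \<open>B \<subset> A\<close> A B T finite_member by (intro card_Diff_subset) (auto simp: Tx_def)
          ultimately have "card B + g \<le> card A" using g by simp
          then have "(card B + g) div g \<le> card A div g" by (rule div_le_mono)
          then show False using A B g by simp
        qed
      qed (use T in \<open>auto simp: Tx_def\<close>)
      then show ?thesis by simp
    qed
    have "(\<Sum>A\<in>Tx. 1 / real (card A)) \<le> (\<Sum>A\<in>Tx. 1 / (real g * real (card A div g)))"
    proof (rule sum_mono)
      fix A assume "A \<in> Tx"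
      have "g * (card A div g) \<le> card A" by simp
      then have "real g * real (card A div g) \<le> real (card A)"
        by (metis of_nat_le_iff of_nat_mult)
      moreover have "0 < real g * real (card A div g)" using pos[OF \<open>A \<in> Tx\<close>] g by simp
      ultimately show "1 / real (card A) \<le> 1 / (real g * real (card A div g))"
        by (intro divide_left_mono) auto
    qed
    also have "\<dots> = (\<Sum>j=1..s. \<Sum>A\<in>{A \<in> Tx. card A div g = j}. 1 / (real g * real (card A div g)))"
    proof (rule sum.group[symmetric])
      have "card A div g \<le> s" if "A \<in> Tx" for A
        using that size[of A] by (intro le_trans[OF div_le_dividend]) (auto simp: Tx_def)
      then show "(\<lambda>A. card A div g) ` Tx \<subseteq> {1..s}" using pos by auto
    qed (use finTx in auto)
    also have "\<dots> = (\<Sum>j=1..s. real (card {A \<in> Tx. card A div g = j}) * (1 / (real g * real j)))"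
      by (intro sum.cong) auto
    also have "\<dots> \<le> (\<Sum>j=1..s. real k * (1 / (real g * real j)))"
      using window by (intro sum_mono mult_right_mono) auto
    also have "\<dots> = real k / real g * (\<Sum>j=1..s. 1 / real j)"
      by (simp add: sum_distrib_left)
    also have "\<dots> \<le> real k / real g * (1 + ln (real s))"
      using sum_inverse_le[OF s] by (intro mult_left_mono) auto
    finally show ?thesis by (simp add: Tx_def)
  qed
  then have "real (card T) \<le> (\<Sum>x\<in>U. real k * (1 + ln (real s)) / real g)"
    unfolding card_eq_sum_inverse_card[OF T] by (rule sum_mono)
  then show ?thesis by (simp add: mult.commute)
qed

text \<open>Take a largest proper subset within the gap, and \<open>A\<close> itself if there is
  none. Members of \<open>Q\<close> are then exactly those without such a subset, which supplies the
  sparsity needed for the weighted count.\<close>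

lemma (in weak_free) ex_pred_family:
  assumes "\<And>A. A \<in> G \<Longrightarrow> s \<le> card A"
  shows "\<exists>P. pred_family k U G P g s \<and>
    (\<forall>A\<in>pred_family.Q G P. \<forall>B\<in>G. B \<subset> A \<longrightarrow> g < card (A - B))"
proof -
  define ok where "ok A B \<longleftrightarrow> B \<in> G \<and> B \<subset> A \<and> card (A - B) \<le> g" for A B
  define P where "P A = (if \<exists>B. ok A B then SOME B. ok A B \<and> (\<forall>B'. ok A B' \<longrightarrow> card B' \<le> card B) else A)" for A
  have P: "ok A (P A) \<and> (\<forall>B'. ok A B' \<longrightarrow> card B' \<le> card (P A))" if "A \<in> G" "ok A B" for A B
  proof -
    have "card B' \<le> card A" if "ok A B'" for B'
      using that finite_member[OF \<open>A \<in> G\<close>] by (intro card_mono) (simp_all add: ok_def psubset_imp_subset)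
    then have "\<exists>B. ok A B \<and> (\<forall>B'. ok A B' \<longrightarrow> card B' \<le> card B)"
      using that(2) by (intro ex_has_greatest_nat[where k = B and b = "Suc (card A)"]) (auto simp: less_Suc_eq_le)
    then have some: "ok A (SOME B. ok A B \<and> (\<forall>B'. ok A B' \<longrightarrow> card B' \<le> card B))
        \<and> (\<forall>B'. ok A B' \<longrightarrow> card B' \<le> card (SOME B. ok A B \<and> (\<forall>B'. ok A B' \<longrightarrow> card B' \<le> card B)))"
      by (rule someI_ex)
    have "P A = (SOME B. ok A B \<and> (\<forall>B'. ok A B' \<longrightarrow> card B' \<le> card B))"
      unfolding P_def using that(2) by (intro if_P) blast
    then show ?thesis using some by (rule ssubst)
  qed
  have P': "P A = A" if "\<nexists>B. ok A B" for A using that by (simp add: P_def)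
  have "pred_family k U G P g s"
  proof
    fix A assume A: "A \<in> G"
    have cases: "P A = A \<and> (\<nexists>B. ok A B) \<or> ok A (P A)" 
    proof (cases "\<exists>B. ok A B")
      case True
      then obtain B where "ok A B" ..
      from P[OF A this] show ?thesis by simp
    qed (simp add: P')
    then show "P A \<in> G" "P A \<subseteq> A" "card (A - P A) \<le> g" "s \<le> card A"
      using A assms by (auto simp: ok_def)
    fix B assume B: "B \<in> G" "B \<subset> A"
    have finA: "finite A" using A finite_member by blast
    consider "P A = A" | "ok A B" | "ok A (P A)" "\<not> ok A B" using cases by blast
    then show "card B \<le> card (P A)"
    proof cases
      case 1
      then show ?thesis using B finA by (auto intro!: card_mono)
    next
      case 2
      from P[OF A this] this show ?thesis by simp
    next
      case 3
      \<comment> \<open>A proper subset that is not admissible misses more than \<open>g\<close>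
        elements, while \<open>P A\<close> misses at most \<open>g\<close>.\<close>
      then have "card (A - P A) < card (A - B)" using B by (auto simp: ok_def)
      moreover have "card (A - B) = card A - card B" "card (A - P A) = card A - card (P A)"
        using 3 B finA by (auto simp: ok_def intro!: card_Diff_subset intro: finite_subset)
      ultimately show ?thesis by simp
    qed
  qed
  moreover from this interpret pred_family k U G P g s .
  have "g < card (A - B)" if "A \<in> Q" "B \<in> G" "B \<subset> A" for A B
  proof -
    have "A \<in> G" "\<not> ok A (P A)" using that(1) by (auto simp: Q_def ok_def)
    then have "\<not> ok A B" using P[of A B] by blast
    then show ?thesis using that by (auto simp: ok_def)
  qed
  ultimately show ?thesis by blast
qed

text \<open>The sparse count bounds \<open>Q\<close> by a multiple of
  \<open>(1 + ln (2 ^ s)) / g\<close> times \<open>card U\<close>. Since the logarithm is at most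
  \<open>s\<close> and \<open>g\<close> is proportional to \<open>s\<close>, the factor is constant;
  this is why a block may reach up to \<open>2 ^ s\<close>.\<close>

lemma block_bound:
  assumes "k \<ge> 1"
  shows "\<exists>C. \<exists>M\<ge>1. \<forall>(U::'a set) G s. weak_free k U G \<longrightarrow> M \<le> s \<longrightarrow>
    (\<forall>A\<in>G. s \<le> card A \<and> card A \<le> 2 ^ s) \<longrightarrow> card G \<le> C * card U"
proof -
  obtain C M where CM: "\<And>(U::'a set) G P g s. pred_family k U G P g s \<Longrightarrow> M * g < s \<Longrightarrow>
    card G \<le> C * (card U + card (pred_family.Q G P))"
    using pred_family_bound[OF assms] by blast
  show ?thesis
  proof (rule exI[of _ "C * (1 + 2 * k * Suc M)"], rule exI[of _ "Suc M"], intro conjI allI impI)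
    fix U :: "'a set" and G s
    assume wf: "weak_free k U G" and s: "Suc M \<le> s"
      and size: "\<forall>A\<in>G. s \<le> card A \<and> card A \<le> 2 ^ s"
    interpret weak_free k U G by (fact wf)
    \<comment> \<open>Dividing by \<open>Suc M\<close> rather than \<open>M\<close> makes
      \<open>M * g < s\<close> strict; \<open>Suc M \<le> s\<close> gives \<open>g \<ge> 1\<close>,
      so rounding costs only a factor 2.\<close>
    define g where "g = s div Suc M"
    have g1: "g \<ge> 1" using s div_le_mono[of "Suc M" s "Suc M"] unfolding g_def by (metis div_self nat.distinct(1))
    have "Suc M * g \<le> s" unfolding g_def by (rule times_div_less_eq_dividend)
    then have Mg: "M * g < s" and gs: "g \<le> s" using g1 by auto
    have "s mod Suc M < Suc M" by simp
    then have "s < Suc M * g + Suc M"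
      using mult_div_mod_eq[of "Suc M" s] unfolding g_def by linarith
    also have "\<dots> \<le> Suc M * g + Suc M * g" using mult_le_mono2[OF g1, of "Suc M"] by (intro add_left_mono) simp
    finally have s_le: "1 + s \<le> 2 * Suc M * g" by simp
    have "\<exists>P. pred_family k U G P g s \<and> (\<forall>A\<in>pred_family.Q G P. \<forall>B\<in>G. B \<subset> A \<longrightarrow> g < card (A - B))"
      by (rule ex_pred_family) (use size in simp)
    then obtain P where P: "pred_family k U G P g s"
      "\<forall>A\<in>pred_family.Q G P. \<forall>B\<in>G. B \<subset> A \<longrightarrow> g < card (A - B)"
      by (elim exE conjE)
    interpret pred_family k U G P g s by (fact P)
    have "Q \<subseteq> G" by (auto simp: Q_def)
    have "real (card Q) \<le> real k * (1 + ln (real (2 ^ s))) / real g * real (card U)"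
    proof (rule card_sparse_le[OF \<open>Q \<subseteq> G\<close> g1])
      show "g \<le> card A \<and> card A \<le> 2 ^ s" if "A \<in> Q" for A
        using that size gs \<open>Q \<subseteq> G\<close> by force
      show "g \<le> card (A - B)" if "A \<in> Q" "B \<in> Q" "B \<subset> A" for A B
        using P(2) that \<open>Q \<subseteq> G\<close> by (meson less_imp_le subsetD)
    qed simp
    also have "\<dots> \<le> real k * real (2 * Suc M) * real (card U)"
    proof (rule mult_right_mono)
      have "ln (real (2 ^ s)) = real s * ln 2" by (simp add: ln_realpow)
      also have "\<dots> \<le> real s" using ln_2_less_1 by (simp add: mult_left_le)
      finally have "1 + ln (real (2 ^ s)) \<le> real (1 + s)" by simp
      also have "\<dots> \<le> real (2 * Suc M * g)" using s_le by (rule of_nat_mono)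
      finally have "(1 + ln (real (2 ^ s))) / real g \<le> real (2 * Suc M)"
        using g1 by (subst pos_divide_le_eq) (auto simp: algebra_simps)
      then have "real k * ((1 + ln (real (2 ^ s))) / real g) \<le> real k * real (2 * Suc M)"
        by (intro mult_left_mono) auto
      then show "real k * (1 + ln (real (2 ^ s))) / real g \<le> real k * real (2 * Suc M)" by simp
    qed simp
    finally have "real (card Q) \<le> real (2 * k * Suc M * card U)" by (simp add: algebra_simps)
    then have "card Q \<le> 2 * k * Suc M * card U" by (simp only: of_nat_le_iff)
    then have "card U + card Q \<le> (1 + 2 * k * Suc M) * card U" by simp
    then have "C * (card U + card Q) \<le> C * ((1 + 2 * k * Suc M) * card U)" by (rule mult_le_mono2)
    with CM[OF P(1) Mg] show "card G \<le> C * (1 + 2 * k * Suc M) * card U"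
      unfolding mult.assoc by (rule order_trans)
  qed simp
qed

subsection \<open>Towers and the iterated logarithm\<close>

text \<open>The base \<open>m\<close> is left free because the block bound only starts at sizes
  above its constant.\<close>

fun tower :: "nat \<Rightarrow> nat \<Rightarrow> nat" where
  "tower m 0 = m"
| "tower m (Suc j) = 2 ^ tower m j"

lemma tower_ge: "m + j \<le> tower m j"
proof (induction j)
  case (Suc j)
  then have "m + Suc j \<le> Suc (tower m j)" by simp
  also have "\<dots> \<le> 2 ^ tower m j" by (rule Suc_leI[OF less_exp])
  finally show ?case by simp
qed simp

lemma tower_mono: "i \<le> j \<Longrightarrow> tower m i \<le> tower m j"
proof (rule lift_Suc_mono_le[of "tower m"])
  show "tower m n \<le> tower m (Suc n)" for n
    unfolding tower.simps by (rule less_imp_le[OF less_exp])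
qed

text \<open>Undoing one logarithm raises the tower by one level, hence the general \<open>r\<close>
  in the induction. Positivity of the earlier iterates is what allows exponentiation.\<close>

lemma iter_log_le_tower_iff:
  assumes "\<And>j. j < i \<Longrightarrow> iter_log j x > 0"
  shows "iter_log i x \<le> real (tower m r) \<longleftrightarrow> x \<le> real (tower m (r + i))"
  using assms
proof (induction i arbitrary: r)
  case 0
  then show ?case by (simp add: iter_log_def)
next
  case (Suc i)
  have "iter_log (Suc i) x \<le> real (tower m r) \<longleftrightarrow> log 2 (iter_log i x) \<le> real (tower m r)"
    by (simp add: iter_log_def)
  also have "\<dots> \<longleftrightarrow> iter_log i x \<le> 2 powr real (tower m r)"
    using Suc.prems[of i] by (intro log_le_iff) auto
  also have "\<dots> \<longleftrightarrow> iter_log i x \<le> real (tower m (Suc r))"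
    by (simp add: powr_realpow)
  also have "\<dots> \<longleftrightarrow> x \<le> real (tower m (Suc r + i))"
    using Suc.prems by (intro Suc.IH) auto
  finally show ?case by simp
qed

text \<open>By maximality some iterate with index at most \<open>Suc (log_star n)\<close> is at most
  1. The iterates before the first such one are positive, so that inequality turns into a bound of
  \<open>n\<close> by a tower.\<close>

lemma log_star_props:
  assumes "n \<ge> 1"
  shows log_star_ge_1: "log_star n \<ge> 1"
    and le_tower_log_star: "m \<ge> 1 \<Longrightarrow> n \<le> tower m (Suc (log_star n))"
proof -
  define I where "I = {i. 1 \<le> i \<and> (\<forall>j\<in>{1..i}. iter_log j (real n) > 1)}"
  have n0: "iter_log 0 (real n) > 0" using assms by (simp add: iter_log_def)
  \<comment> \<open>The maximum is meaningful only for a finite set: the \<open>n\<close>-th iterate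
    cannot exceed 1, as \<open>n\<close> is below a tower of height \<open>n\<close> over 1.\<close>
  have "i \<le> n" if "i \<in> I" for i
  proof (rule ccontr)
    assume "\<not> i \<le> n"
    then have *: "iter_log j (real n) > 1" if "1 \<le> j" "j \<le> n" for j
      using that \<open>i \<in> I\<close> by (auto simp: I_def)
    have "iter_log j (real n) > 0" if "j < n" for j
      using n0 *[of j] that by (cases "j = 0") auto
    then have "iter_log n (real n) \<le> real (tower 1 0)"
      using tower_ge[of 1 n] by (subst iter_log_le_tower_iff) auto
    then show False using *[of n] assms by simp
  qed
  then have finI: "finite ({1} \<union> I)" by (auto intro: finite_subset[of _ "{..n}"])
  have L: "log_star n = Max ({1} \<union> I)" by (simp add: log_star_def I_def)
  show L1: "log_star n \<ge> 1" unfolding L using finI by (intro Max_ge) auto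
  assume m: "m \<ge> 1"
  have "Suc (log_star n) \<notin> I"
  proof
    assume "Suc (log_star n) \<in> I"
    then have "Suc (log_star n) \<le> log_star n" using finI unfolding L by (intro Max_ge) auto
    then show False by simp
  qed
  then have "\<exists>j. 1 \<le> j \<and> j \<le> Suc (log_star n) \<and> iter_log j (real n) \<le> 1"
    by (auto simp: I_def not_less)
  then obtain j where j: "1 \<le> j \<and> j \<le> Suc (log_star n) \<and> iter_log j (real n) \<le> 1"
    and least: "\<And>i. i < j \<Longrightarrow> \<not> (1 \<le> i \<and> i \<le> Suc (log_star n) \<and> iter_log i (real n) \<le> 1)"
    using exists_least_iff[of "\<lambda>j. 1 \<le> j \<and> j \<le> Suc (log_star n) \<and> iter_log j (real n) \<le> 1"] by blast
  have "iter_log i (real n) > 0" if "i < j" for i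
    using n0 least[OF that] that j by (cases "i = 0") auto
  then have "iter_log j (real n) \<le> real (tower m 0) \<longleftrightarrow> real n \<le> real (tower m (0 + j))"
    by (rule iter_log_le_tower_iff)
  moreover have "iter_log j (real n) \<le> real (tower m 0)" using j m by simp
  ultimately have "n \<le> tower m j" by simp
  also have "\<dots> \<le> tower m (Suc (log_star n))" using j by (intro tower_mono) simp
  finally show "n \<le> tower m (Suc (log_star n))" .
qed

section \<open>Summation over the blocks of sizes\<close>

text \<open>Sets of size at most \<open>M\<close> are covered by the sparse count with gap 1, which
  every proper inclusion satisfies. Each further tower level adds one block of at most
  \<open>C * n\<close> sets. The extra level and \<open>C0\<close> are absorbed because
  \<open>log_star n \<ge> 1\<close>.\<close>

lemma weak_free_bound:
  assumes "k \<ge> 1"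
  shows "\<exists>C\<ge>0. \<forall>n\<ge>1. \<forall>G. weak_free k {1..n} G \<longrightarrow>
    real (card G) \<le> C * real n * real (log_star n)"
proof -
  obtain C M where M: "M \<ge> 1" and C: "\<And>(U::nat set) G s. weak_free k U G \<Longrightarrow> M \<le> s \<Longrightarrow>
    (\<forall>A\<in>G. s \<le> card A \<and> card A \<le> 2 ^ s) \<Longrightarrow> card G \<le> C * card U"
    using block_bound[OF assms] by blast
  define C0 where "C0 = real k * (1 + ln (real M))"
  have C0: "C0 \<ge> 0" using M by (simp add: C0_def)
  show ?thesis
  proof (rule exI[of _ "C0 + 2 * real C"], intro conjI allI impI)
    fix n :: nat and G assume n: "n \<ge> 1" and wf: "weak_free k {1..n} G"
    interpret weak_free k "{1..n}" G by (fact wf)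
    have tower_bound: "real (card {A \<in> G. card A \<le> tower M j}) \<le> (C0 + real j * real C) * real n" for j
    proof (induction j)
      case 0
      have "real (card {A \<in> G. card A \<le> M}) \<le> real k * (1 + ln (real M)) / real 1 * real (card {1..n})"
      proof (rule card_sparse_le)
        have "1 \<le> card A" if "A \<in> G" for A
          using that G_ne finite_member[of A] by (auto simp: Suc_le_eq card_gt_0_iff)
        then show "1 \<le> card A \<and> card A \<le> M" if "A \<in> {A \<in> G. card A \<le> M}" for A using that by auto
        show "1 \<le> card (A - B)" if "A \<in> {A \<in> G. card A \<le> M}" "B \<subset> A" for A B
        proof -
          have "A - B \<noteq> {}" "finite (A - B)" using that finite_member by auto
          then show ?thesis by (simp add: Suc_le_eq card_gt_0_iff)
        qed
      qed (use M in auto)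
      then show ?case by (simp add: C0_def)
    next
      case (Suc j)
      let ?B = "{A \<in> G. tower M j \<le> card A \<and> card A \<le> 2 ^ tower M j}"
      have "card ?B \<le> C * card {1..n}"
      proof (rule C)
        show "weak_free k {1..n} ?B" by (rule weak_free_subset) auto
        show "M \<le> tower M j" using tower_ge[of M j] by simp
      qed simp
      then have B: "real (card ?B) \<le> real C * real n"
        by (metis card_atLeastAtMost diff_Suc_1 of_nat_le_iff of_nat_mult)
      have "card {A \<in> G. card A \<le> tower M (Suc j)} \<le> card ({A \<in> G. card A \<le> tower M j} \<union> ?B)"
        using finite_G by (intro card_mono) auto
      also have "\<dots> \<le> card {A \<in> G. card A \<le> tower M j} + card ?B" by (rule card_Un_le)
      finally have "real (card {A \<in> G. card A \<le> tower M (Suc j)})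
          \<le> real (card {A \<in> G. card A \<le> tower M j}) + real (card ?B)" by linarith
      then show ?case using Suc B by (simp add: algebra_simps)
    qed
    let ?L = "log_star n"
    have L: "?L \<ge> 1" using log_star_ge_1[OF n] .
    have "card A \<le> tower M (Suc ?L)" if "A \<in> G" for A
    proof -
      have "card A \<le> card {1..n}" using that G_sub by (intro card_mono) auto
      then show ?thesis using le_tower_log_star[OF n M] by simp
    qed
    then have "{A \<in> G. card A \<le> tower M (Suc ?L)} = G" by auto
    then have "real (card G) \<le> (C0 + real (Suc ?L) * real C) * real n"
      using tower_bound[of "Suc ?L"] by simp
    also have "\<dots> \<le> ((C0 + 2 * real C) * real ?L) * real n"
    proof (rule mult_right_mono)
      have "C0 * 1 \<le> C0 * real ?L" "real C * 1 \<le> real C * real ?L"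
        using L C0 by (intro mult_left_mono; simp)+
      then show "C0 + real (Suc ?L) * real C \<le> (C0 + 2 * real C) * real ?L"
        by (simp add: algebra_simps)
    qed simp
    finally show "real (card G) \<le> (C0 + 2 * real C) * real n * real ?L" by (simp add: mult_ac)
  qed (use C0 in simp)
qed

section \<open>Reduction from crossing to weak crossing\<close>

text \<open>Serves for the identity and for complementation as \<open>f\<close>. Injectivity keeps
  the number of sets, and cutting down to exactly \<open>k\<close> of them matches the definition of
  \<open>k_cross_free\<close>.\<close>

lemma weak_free_of_k_cross_free:
  assumes "k_cross_free n k F" and H: "H \<subseteq> Pow {1..n}" "{} \<notin> H"
    and f: "inj_on f H" "f ` H \<subseteq> F"
    and cross: "\<And>A B. A \<in> H \<Longrightarrow> B \<in> H \<Longrightarrow> weakly_crossing A B \<Longrightarrow> crossing n (f A) (f B)"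
  shows "weak_free k {1..n} H"
proof
  fix S assume S: "S \<subseteq> H" "pairwise weakly_crossing S"
  show "card S < k"
  proof (rule ccontr)
    assume "\<not> card S < k"
    then obtain S' where S': "S' \<subseteq> S" "card S' = k"
      by (meson not_less obtain_subset_with_card_n)
    have SH: "S' \<subseteq> H" using S' S by blast
    have "card (f ` S') = k"
      using card_image[OF inj_on_subset[OF f(1) SH]] S' by simp
    moreover have "crossing n A B" if "A \<in> f ` S'" "B \<in> f ` S'" "A \<noteq> B" for A B
    proof -
      obtain X Y where XY: "X \<in> S'" "Y \<in> S'" "A = f X" "B = f Y" "X \<noteq> Y"
        using \<open>A \<in> f ` S'\<close> \<open>B \<in> f ` S'\<close> \<open>A \<noteq> B\<close> by blast
      then have "weakly_crossing X Y" using S(2) S'(1) unfolding pairwise_def by blast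
      then show ?thesis using cross XY SH by blast
    qed
    moreover have "f ` S' \<subseteq> F" using SH f(2) by blast
    ultimately show False using assms(1) unfolding k_cross_free_def by blast
  qed
qed (use H in auto)

theorem theorem1:
  fixes k :: nat
  assumes "k \<ge> 2"
  shows "\<exists>c>0. \<forall>n::nat. \<forall>F. n \<ge> 1 \<longrightarrow> F \<subseteq> Pow {1..n} \<longrightarrow> k_cross_free n k F \<longrightarrow>
           real (card F) \<le> c * real n * real (log_star n)"
proof -
  obtain C where C: "C \<ge> 0" "\<And>n G. n \<ge> 1 \<Longrightarrow> weak_free k {1..n} G \<Longrightarrow>
      real (card G) \<le> C * real n * real (log_star n)"
    using weak_free_bound[of k] assms by auto
  show ?thesis
  proof (rule exI[of _ "2 * C + 2"], intro conjI allI impI)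
    fix n :: nat and F assume n: "n \<ge> 1" and F: "F \<subseteq> Pow {1..n}" "k_cross_free n k F"
    have finF: "finite F" using F(1) finite_subset by fastforce
    define F1 F2 where "F1 = {A \<in> F. n \<notin> A}" and "F2 = {A \<in> F. n \<in> A}"
    let ?c = "\<lambda>A. {1..n} - A"
    have "weak_free k {1..n} (F1 - {{}})"
    proof (rule weak_free_of_k_cross_free[OF F(2), of _ "\<lambda>A. A"])
      \<comment> \<open>The point \<open>n\<close> lies outside both sets and supplies the fourth
        condition of crossing.\<close>
      show "crossing n A B" if "A \<in> F1 - {{}}" "B \<in> F1 - {{}}" "weakly_crossing A B" for A B
        using that n unfolding crossing_def weakly_crossing_def F1_def by auto
    qed (use F in \<open>auto simp: F1_def\<close>)
    then have 1: "real (card (F1 - {{}})) \<le> C * real n * real (log_star n)" by (rule C(2)[OF n])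
    have inv: "?c (?c A) = A" if "A \<in> F" for A
      using that F(1) by (intro double_diff) auto
    have "weak_free k {1..n} (?c ` F2 - {{}})"
    proof (rule weak_free_of_k_cross_free[OF F(2), of _ ?c])
      \<comment> \<open>Complementation swaps the two differences, and turns the intersection into
        the complement of the union; \<open>n\<close> is now the common point.\<close>
      show "crossing n (?c A) (?c B)"
        if "A \<in> ?c ` F2 - {{}}" "B \<in> ?c ` F2 - {{}}" "weakly_crossing A B" for A B
      proof -
        have "n \<notin> A" "n \<notin> B" "A \<subseteq> {1..n}" "B \<subseteq> {1..n}" using that by (auto simp: F2_def)
        then show ?thesis using that(3) n unfolding crossing_def weakly_crossing_def by auto
      qed
      show "inj_on ?c (?c ` F2 - {{}})" using F(1) by (auto simp: inj_on_def)
      show "?c ` (?c ` F2 - {{}}) \<subseteq> F" using inv by (auto simp: F2_def)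
    qed auto
    then have 2: "real (card (?c ` F2 - {{}})) \<le> C * real n * real (log_star n)" by (rule C(2)[OF n])
    have "inj_on ?c F2" by (rule inj_on_inverseI[of _ ?c], rule inv) (simp add: F2_def)
    then have "card F2 = card (?c ` F2)" by (simp add: card_image)
    \<comment> \<open>Each half loses at most the empty set; the resulting additive 2 is absorbed at
      the end since \<open>n\<close> and \<open>log_star n\<close> are at least 1.\<close>
    also have "\<dots> \<le> Suc (card (?c ` F2 - {{}}))"
      using diff_card_le_card_Diff[of "{{}}" "?c ` F2"] by simp
    finally have "card F2 \<le> Suc (card (?c ` F2 - {{}}))" .
    moreover have "card F1 \<le> Suc (card (F1 - {{}}))"
      using diff_card_le_card_Diff[of "{{}}" F1] by simp
    moreover have "card F = card F1 + card F2"
      using finF by (subst card_Un_disjoint[symmetric]) (auto simp: F1_def F2_def intro!: arg_cong[where f = card])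
    ultimately have "real (card F) \<le> 2 * (C * real n * real (log_star n)) + 2" using 1 2 by linarith
    moreover have "1 * 1 \<le> real n * real (log_star n)"
      using n log_star_ge_1[OF n] by (intro mult_mono) auto
    ultimately show "real (card F) \<le> (2 * C + 2) * real n * real (log_star n)"
      by (simp add: algebra_simps)
  qed (use C in simp)
qed

end
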